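(* Let $M$ be a length space with a distinguished point $0\in M$ (not assumed complete). Then the Lipschitz-free space $\mathcal{F}(M)$ has the attaining strong diameter two property (ASD2P).
   Context: All Banach spaces are real. For a Banach space $X$, $B_X$ is the closed unit ball, $S_X$ the unit sphere, $X^*$ the dual space. Lipschitz-free space: for a metric space $(M,d)$ with distinguished point $0\in M$, $\operatorname{Lip}_0(M)$ is the Banach space of all real-valued Lipschitz functions on $M$ vanishing at $0$, with norm $\|f\|=\sup\{|f(p)-f(q)|/d(p,q): p,q\in M,\ p\neq q\}$. Let $\delta\colon M\to \operatorname{Lip}_0(M)^*$ be given by $\langle f,\delta(p)\rangle=f(p)$. Then $\mathcal{F}(M)$ is the norm-closed linear span of $\delta(M)$ in $\operatorname{Lip}_0(M)^*$, with the inherited norm; it is a predual of $\operatorname{Lip}_0(M)$, i.e. $\mathcal{F}(M)^*=\operatorname{Lip}_0(M)$ isometrically via the pairing $\langle f,\mu\rangle=\mu(f)$ for $f\in\operatorname{Lip}_0(M)$ and $\mu\in\mathcal{F}(M)\subset\operatorname{Lip}_0(M)^*$ (so that $\langle f,\delta(p)\rangle=f(p)$ for $p\in M$). Length space: a path joining $p$ and $q$ is a continuous map $\gamma\colon[0,1]\to M$ with $\gamma(0)=p$, $\gamma(1)=q$; its length is $L(\gamma)=\sup\{\sum_{i=0}^{n-1} d(\gamma(t_i),\gamma(t_{i+1})): n\in\mathbb{N},\ 0=t_0\le\dots\le t_n=1\}$. A metric space $M$ is a length space if for all $p,q\in M$, $d(p,q)=\inf\{L(\gamma): \gamma \text{ is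 a path joining } p \text{ and } q\}$ (with $\inf\emptyset=\infty$). Slices: for $x^*\in S_{X^*}$ and $\alpha>0$, the slice of $B_X$ determined by $x^*$ and $\alpha$ is $S(x^*,\alpha)=\{x\in B_X: x^*(x)>1-\alpha\}$. A convex combination of slices of $B_X$ is a set of the form $\sum_{i=1}^n\lambda_i S_i=\{\sum_{i=1}^n\lambda_i x_i: x_i\in S_i\}$ with $n\in\mathbb{N}$ ($n\ge 1$), $\lambda_i>0$, $\sum_{i=1}^n\lambda_i=1$, and $S_1,\dots,S_n$ slices of $B_X$. ASD2P: a Banach space $X$ has the attaining strong diameter two property if every convex combination of slices of $B_X$ contains two points $x,y$ with $\|x-y\|=2$. *)

theory Defs
  imports "HOL-Analysis.Analysis"
begin

section \<open>Length spaces\<close>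

definition path_length :: "(real \<Rightarrow> 'a::metric_space) \<Rightarrow> ereal" where
  "path_length \<gamma> =
     (SUP (n, t) \<in> {(n, t :: nat \<Rightarrow> real). t 0 = 0 \<and> t n = 1 \<and> (\<forall>i<n. t i \<le> t (Suc i))}.
        ereal (\<Sum>i<n. dist (\<gamma> (t i)) (\<gamma> (t (Suc i)))))"

text \<open>The infimum is taken in the extended reals, so that it is infinite if no path joins
  \<open>p\<close> and \<open>q\<close>.\<close>

definition length_space :: "'a::metric_space itself \<Rightarrow> bool" where
  "length_space _ \<longleftrightarrow>
     (\<forall>p q :: 'a. ereal (dist p q) =
        (INF \<gamma> \<in> {\<gamma>. path \<gamma> \<and> pathstart \<gamma> = p \<and> pathfinish \<gamma> = q}. path_length \<gamma>))"


section \<open>The space of Lipschitz functions vanishing at the distinguished point\<close>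

text \<open>A pointed metric space is a type of sort \<open>{metric_space, zero}\<close>. The class \<open>zero\<close> has no
  axioms: its only parameter \<open>0\<close> is an arbitrary point, which serves as the distinguished one and
  is not assumed to be related to the metric.\<close>

typedef (overloaded) 'a lip0 =
  "{f :: 'a::{metric_space, zero} \<Rightarrow> real. (\<exists>L. L-lipschitz_on UNIV f) \<and> f 0 = 0}"
  morphisms lip0_apply Abs_lip0
proof -
  have "0-lipschitz_on UNIV (\<lambda>_::'a. 0::real)" by (rule lipschitz_on_constant)
  then show ?thesis by (intro exI[of _ "\<lambda>_. 0"]) auto
qed

setup_lifting type_definition_lip0

definition slopes :: "('a::metric_space \<Rightarrow> real) \<Rightarrow> real set" where
  "slopes f = {\<bar>f p - f q\<bar> / dist p q | p q. p \<noteq> q}"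

instantiation lip0 :: ("{metric_space, zero}") real_vector
begin

lift_definition zero_lip0 :: "'a lip0" is "\<lambda>_. 0"
  using lipschitz_on_constant by auto

lift_definition plus_lip0 :: "'a lip0 \<Rightarrow> 'a lip0 \<Rightarrow> 'a lip0" is "\<lambda>f g x. f x + g x"
  using lipschitz_on_add by fastforce

lift_definition minus_lip0 :: "'a lip0 \<Rightarrow> 'a lip0 \<Rightarrow> 'a lip0" is "\<lambda>f g x. f x - g x"
  using lipschitz_on_diff by fastforce

lift_definition uminus_lip0 :: "'a lip0 \<Rightarrow> 'a lip0" is "\<lambda>f x. - f x"
  using lipschitz_on_minus by fastforce

lift_definition scaleR_lip0 :: "real \<Rightarrow> 'a lip0 \<Rightarrow> 'a lip0" is "\<lambda>c f x. c * f x"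
  using lipschitz_on_cmult_real by fastforce

instance
  by standard (transfer; force simp: algebra_simps)+

end

lemma lip0_apply_simps [simp]:
  "lip0_apply 0 p = 0"
  "lip0_apply (f + g) p = lip0_apply f p + lip0_apply g p"
  "lip0_apply (f - g) p = lip0_apply f p - lip0_apply g p"
  "lip0_apply (- f) p = - lip0_apply f p"
  "lip0_apply (c *\<^sub>R f) p = c * lip0_apply f p"
  by (transfer; simp)+

lemma lip0_apply_zero [simp]: "lip0_apply f 0 = 0"
  by transfer simp

lemma bdd_above_slopes: "bdd_above (insert 0 (slopes (lip0_apply f)))"
proof -
  obtain L where L: "L-lipschitz_on UNIV (lip0_apply f)"
    using lip0_apply[of f] by auto
  have "x \<le> L" if "x \<in> slopes (lip0_apply f)" for x
    using that lipschitz_onD[OF L] by (auto simp: slopes_def dist_real_def divide_le_eq)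
  then show ?thesis by (auto intro!: bdd_aboveI[of _ L])
qed

lemma slope_le_Sup:
  "\<bar>lip0_apply f p - lip0_apply f q\<bar> \<le> Sup (insert 0 (slopes (lip0_apply f))) * dist p q"
proof (cases "p = q")
  case False
  then have "\<bar>lip0_apply f p - lip0_apply f q\<bar> / dist p q \<le> Sup (insert 0 (slopes (lip0_apply f)))"
    by (intro cSup_upper bdd_above_slopes) (auto simp: slopes_def)
  then show ?thesis using False by (simp add: divide_le_eq)
qed simp

text \<open>Inserting \<open>0\<close> only matters if the metric space is a single point, where the supremum would
  otherwise be that of the empty set of reals.\<close>

instantiation lip0 :: ("{metric_space, zero}") real_normed_vector
begin

definition norm_lip0 :: "'a lip0 \<Rightarrow> real" where
  "norm_lip0 f = Sup (insert 0 (slopes (lip0_apply f)))"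

definition sgn_lip0 :: "'a lip0 \<Rightarrow> 'a lip0" where
  "sgn_lip0 f = inverse (norm f) *\<^sub>R f"

definition dist_lip0 :: "'a lip0 \<Rightarrow> 'a lip0 \<Rightarrow> real" where
  "dist_lip0 f g = norm (f - g)"

definition uniformity_lip0 :: "('a lip0 \<times> 'a lip0) filter" where
  "uniformity_lip0 = (INF e\<in>{0<..}. principal {(f, g). dist f g < e})"

definition open_lip0 :: "'a lip0 set \<Rightarrow> bool" where
  "open_lip0 U \<longleftrightarrow> (\<forall>f\<in>U. \<forall>\<^sub>F (f', g) in uniformity. f' = f \<longrightarrow> g \<in> U)"

instance
proof
  fix f g :: "'a lip0" and c :: real
  have nonneg: "0 \<le> norm f" for f :: "'a lip0"
    unfolding norm_lip0_def by (intro cSup_upper bdd_above_slopes) simp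
  have bound: "\<bar>lip0_apply f p - lip0_apply f q\<bar> \<le> norm f * dist p q" for f :: "'a lip0" and p q
    unfolding norm_lip0_def by (rule slope_le_Sup)
  have least: "norm f \<le> L"
    if "0 \<le> L" "\<And>p q. \<bar>lip0_apply f p - lip0_apply f q\<bar> \<le> L * dist p q" for f :: "'a lip0" and L
    unfolding norm_lip0_def
    by (rule cSup_least) (use that in \<open>auto simp: slopes_def divide_le_eq\<close>)
  show "norm f = 0 \<longleftrightarrow> f = 0"
  proof
    assume "norm f = 0"
    then have "lip0_apply f p = 0" for p
      using bound[of f p 0] by simp
    then show "f = 0" by transfer auto
  next
    assume "f = 0"
    then show "norm f = 0" using least[of 0 f] nonneg[of f] by simp
  qed
  show "norm (f + g) \<le> norm f + norm g"
  proof (rule least)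
    fix p q
    show "\<bar>lip0_apply (f + g) p - lip0_apply (f + g) q\<bar> \<le> (norm f + norm g) * dist p q"
      using bound[of f p q] bound[of g p q] by (simp add: distrib_right)
  qed (use nonneg[of f] nonneg[of g] in simp)
  have scale_le: "norm (c *\<^sub>R f) \<le> \<bar>c\<bar> * norm f" for c and f :: "'a lip0"
  proof (rule least)
    fix p q
    have "\<bar>lip0_apply (c *\<^sub>R f) p - lip0_apply (c *\<^sub>R f) q\<bar> =
        \<bar>c\<bar> * \<bar>lip0_apply f p - lip0_apply f q\<bar>"
      by (simp flip: right_diff_distrib abs_mult)
    also have "\<dots> \<le> \<bar>c\<bar> * (norm f * dist p q)"
      by (intro mult_left_mono bound) simp
    finally show "\<bar>lip0_apply (c *\<^sub>R f) p - lip0_apply (c *\<^sub>R f) q\<bar> \<le> \<bar>c\<bar> * norm f * dist p q"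
      by (simp add: mult.assoc)
  qed (use nonneg[of f] in simp)
  show "norm (c *\<^sub>R f) = \<bar>c\<bar> * norm f"
  proof (cases "c = 0")
    case True
    then show ?thesis using scale_le[of c f] nonneg[of "c *\<^sub>R f"] by simp
  next
    case False
    then have "\<bar>c\<bar> * norm f \<le> \<bar>c\<bar> * (\<bar>inverse c\<bar> * norm (c *\<^sub>R f))"
      using scale_le[of "inverse c" "c *\<^sub>R f"] by (intro mult_left_mono) auto
    also have "\<dots> = norm (c *\<^sub>R f)"
      using False by (simp add: abs_inverse)
    finally show ?thesis using scale_le[of c f] by simp
  qed
qed (simp_all add: dist_lip0_def sgn_lip0_def uniformity_lip0_def open_lip0_def)

end

lemma lip0_apply_diff_le: "\<bar>lip0_apply f p - lip0_apply f q\<bar> \<le> norm f * dist p q"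
  unfolding norm_lip0_def by (rule slope_le_Sup)


section \<open>The Lipschitz-free space\<close>

lift_definition delta :: "'a::{metric_space, zero} \<Rightarrow> 'a lip0 \<Rightarrow>\<^sub>L real" is "\<lambda>p f. lip0_apply f p"
proof
  fix p :: 'a
  show "\<exists>K. \<forall>f. norm (lip0_apply f p) \<le> norm f * K"
    using lip0_apply_diff_le[of _ p 0] by (intro exI[of _ "dist p 0"]) simp
qed simp_all

typedef (overloaded) 'a lipschitz_free =
  "closure (span (range (delta :: 'a::{metric_space, zero} \<Rightarrow> 'a lip0 \<Rightarrow>\<^sub>L real)))"
  morphisms free_functional Abs_lipschitz_free
  using closure_subset span_zero by blast

setup_lifting type_definition_lipschitz_free

lemma subspace_closure:
  fixes S :: "'b::real_normed_vector set"
  assumes "subspace S"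
  shows "subspace (closure S)"
proof (rule subspaceI)
  show "0 \<in> closure S"
    using closure_subset subspace_0[OF assms] by blast
next
  fix x y assume "x \<in> closure S" "y \<in> closure S"
  then obtain u v where "\<forall>n::nat. u n \<in> S" "u \<longlonglongrightarrow> x" "\<forall>n::nat. v n \<in> S" "v \<longlonglongrightarrow> y"
    unfolding closure_sequential by blast
  then have "(\<forall>n. u n + v n \<in> S) \<and> (\<lambda>n. u n + v n) \<longlonglongrightarrow> x + y"
    by (auto intro: tendsto_add subspace_add[OF assms])
  then show "x + y \<in> closure S"
    unfolding closure_sequential by (intro exI)
next
  fix c :: real and x assume "x \<in> closure S"
  then obtain u where "\<forall>n::nat. u n \<in> S" "u \<longlonglongrightarrow> x"
    unfolding closure_sequential by blast
  then have "(\<forall>n. c *\<^sub>R u n \<in> S) \<and> (\<lambda>n. c *\<^sub>R u n) \<longlonglongrightarrow> c *\<^sub>R x"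
    by (auto intro: tendsto_scaleR subspace_scale[OF assms])
  then show "c *\<^sub>R x \<in> closure S"
    unfolding closure_sequential by (intro exI)
qed

lemma subspace_lipschitz_free:
  "subspace (closure (span (range (delta :: 'a::{metric_space, zero} \<Rightarrow> 'a lip0 \<Rightarrow>\<^sub>L real))))"
  by (intro subspace_closure subspace_span)

instantiation lipschitz_free :: ("{metric_space, zero}") real_normed_vector
begin

lift_definition zero_lipschitz_free :: "'a lipschitz_free" is 0
  by (rule subspace_0[OF subspace_lipschitz_free])

lift_definition plus_lipschitz_free ::
  "'a lipschitz_free \<Rightarrow> 'a lipschitz_free \<Rightarrow> 'a lipschitz_free" is "(+)"
  by (rule subspace_add[OF subspace_lipschitz_free])

lift_definition minus_lipschitz_free ::
  "'a lipschitz_free \<Rightarrow> 'a lipschitz_free \<Rightarrow> 'a lipschitz_free" is "(-)"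
  by (rule subspace_diff[OF subspace_lipschitz_free])

lift_definition uminus_lipschitz_free :: "'a lipschitz_free \<Rightarrow> 'a lipschitz_free" is uminus
  by (rule subspace_neg[OF subspace_lipschitz_free])

lift_definition scaleR_lipschitz_free :: "real \<Rightarrow> 'a lipschitz_free \<Rightarrow> 'a lipschitz_free" is scaleR
  by (rule subspace_scale[OF subspace_lipschitz_free])

lift_definition norm_lipschitz_free :: "'a lipschitz_free \<Rightarrow> real" is norm .

definition sgn_lipschitz_free :: "'a lipschitz_free \<Rightarrow> 'a lipschitz_free" where
  "sgn_lipschitz_free \<mu> = inverse (norm \<mu>) *\<^sub>R \<mu>"

definition dist_lipschitz_free :: "'a lipschitz_free \<Rightarrow> 'a lipschitz_free \<Rightarrow> real" where
  "dist_lipschitz_free \<mu> \<nu> = norm (\<mu> - \<nu>)"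

definition uniformity_lipschitz_free :: "('a lipschitz_free \<times> 'a lipschitz_free) filter" where
  "uniformity_lipschitz_free = (INF e\<in>{0<..}. principal {(\<mu>, \<nu>). dist \<mu> \<nu> < e})"

definition open_lipschitz_free :: "'a lipschitz_free set \<Rightarrow> bool" where
  "open_lipschitz_free U \<longleftrightarrow> (\<forall>\<mu>\<in>U. \<forall>\<^sub>F (\<mu>', \<nu>) in uniformity. \<mu>' = \<mu> \<longrightarrow> \<nu> \<in> U)"

instance
proof
  fix \<mu> \<nu> :: "'a lipschitz_free" and c :: real
  show "norm (\<mu> + \<nu>) \<le> norm \<mu> + norm \<nu>" by transfer (rule norm_triangle_ineq)
qed (simp_all add: dist_lipschitz_free_def sgn_lipschitz_free_def uniformity_lipschitz_free_def
      open_lipschitz_free_def, (transfer; simp add: algebra_simps)+)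

end

lemma dist_free_functional: "dist (free_functional \<mu>) (free_functional \<nu>) = dist \<mu> \<nu>"
  unfolding dist_lipschitz_free_def dist_norm by transfer simp

instance lipschitz_free :: ("{metric_space, zero}") banach
proof
  fix X :: "nat \<Rightarrow> 'a lipschitz_free"
  assume "Cauchy X"
  then have "Cauchy (\<lambda>n. free_functional (X n))"
    by (simp add: Cauchy_def dist_free_functional)
  then obtain l where l: "(\<lambda>n. free_functional (X n)) \<longlonglongrightarrow> l"
    using convergent_def Cauchy_convergent by blast
  have "l \<in> closure (span (range delta))"
    by (rule closed_sequentially[OF closed_closure _ l]) (rule free_functional)
  then have "l = free_functional (Abs_lipschitz_free l)"
    by (simp add: Abs_lipschitz_free_inverse)
  with l have "X \<longlonglongrightarrow> Abs_lipschitz_free l"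
    by (metis (no_types, lifting) dist_free_functional metric_LIMSEQ_D metric_LIMSEQ_I)
  then show "convergent X" by (auto simp: convergent_def)
qed


section \<open>The attaining strong diameter two property\<close>

definition slice :: "('b::real_normed_vector \<Rightarrow>\<^sub>L real) \<Rightarrow> real \<Rightarrow> 'b set" where
  "slice f \<alpha> = {x \<in> cball 0 1. blinfun_apply f x > 1 - \<alpha>}"

definition is_slice :: "'b::real_normed_vector set \<Rightarrow> bool" where
  "is_slice S \<longleftrightarrow> (\<exists>f \<alpha>. norm f = 1 \<and> \<alpha> > 0 \<and> S = slice f \<alpha>)"

definition convex_combination_of_slices :: "'b::real_normed_vector set \<Rightarrow> bool" where
  "convex_combination_of_slices C \<longleftrightarrow>
     (\<exists>(n::nat) (c :: nat \<Rightarrow> real) S.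
        n \<ge> 1 \<and> (\<forall>i\<in>{1..n}. c i > 0 \<and> is_slice (S i)) \<and> (\<Sum>i=1..n. c i) = 1 \<and>
        C = {(\<Sum>i=1..n. c i *\<^sub>R x i) | x. \<forall>i\<in>{1..n}. x i \<in> S i})"

definition ASD2P :: "'b::banach itself \<Rightarrow> bool" where
  "ASD2P _ \<longleftrightarrow>
     (\<forall>C :: 'b set. convex_combination_of_slices C \<longrightarrow> (\<exists>x\<in>C. \<exists>y\<in>C. norm (x - y) = 2))"

end

theory Submission
  imports Defs
begin

text \<open>The diameter \<open>2\<close> is witnessed by a single \<open>1\<close>-Lipschitz function. A slice of the unit ball of
  the free space is given by a function \<open>f\<close> of Lipschitz constant \<open>1\<close>, and it contains the
  normalised molecule \<open>(\<delta>(p) - \<delta>(q)) / d(p, q)\<close> as soon as \<open>f\<close> is steep from \<open>q\<close> to \<open>p\<close>, that is,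
  \<open>f(p) - f(q) > \<beta> d(p, q)\<close> for a suitable \<open>\<beta> < 1\<close>. If each of the \<open>n\<close> slices supplies two such
  pairs, and a \<open>1\<close>-Lipschitz \<open>g\<close> satisfies \<open>g(p) - g(q) = d(p, q)\<close> on the first and
  \<open>g(p) - g(q) = -d(p, q)\<close> on the second pair of every slice, then \<open>g\<close> takes the values \<open>1\<close> and
  \<open>-1\<close> on the two corresponding convex combinations of molecules, which are thus at distance \<open>2\<close>.

  Such a \<open>g\<close> is a signed sum of tents, one around the first point of each pair
  (\<open>lipschitz_signed_tents\<close>), provided that the \<open>2n\<close> pairs are short compared with their mutual
  distances. So it suffices that \<open>f\<close> is steep at arbitrarily small scale near infinitely many
  points, because then \<open>2n\<close> distinct points can be chosen before the short pairs.
  This is where the length space enters. Along a path from \<open>p\<close> to \<open>q\<close> which is almost as short as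
  \<open>d(p, q)\<close>, every fine subdivision has a steep step, so by compactness of the path \<open>f\<close> is steep
  near some point of it (\<open>steep_near_exists\<close>); compactness of the path replaces completeness of the
  space. To find a further such point away from \<open>y\<close>, flatten \<open>f\<close> on a narrow band of values around
  \<open>f(y)\<close>: this destroys all steepness near \<open>y\<close>, creates none elsewhere, and changes the increment
  \<open>f(p) - f(q)\<close> so little that the pair stays steep (\<open>steep_near_avoiding\<close>).\<close>

section \<open>Points near which a function is steep\<close>

definition steep_near :: "('a::metric_space \<Rightarrow> real) \<Rightarrow> real \<Rightarrow> 'a set" where
  "steep_near f \<beta> = {x. \<forall>r>0. \<exists>p\<in>ball x r. \<exists>q\<in>ball x r. f p - f q > \<beta> * dist p q}"

lemma subdivision_le_path_length:
  assumes "N > 0"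
  shows "ereal (\<Sum>i<N. dist (\<gamma> (real i / real N)) (\<gamma> (real (Suc i) / real N))) \<le> path_length \<gamma>"
  unfolding path_length_def
  by (rule SUP_upper2[of "(N, \<lambda>i. real i / real N)"]) (use assms in \<open>auto simp: divide_right_mono\<close>)

text \<open>If each step of a subdivision failed to be steep, summing the increments of \<open>f\<close> along the path
  would give at most \<open>\<beta>\<close> times its length.\<close>

lemma steep_step_of_path:
  assumes "path \<gamma>" and len: "path_length \<gamma> < ereal B" and "\<beta> > 0"
    and B: "\<beta> * B \<le> f (pathstart \<gamma>) - f (pathfinish \<gamma>)" and "N > 0"
  obtains i where "i < N"
    "f (\<gamma> (real i / real N)) - f (\<gamma> (real (Suc i) / real N))
       > \<beta> * dist (\<gamma> (real i / real N)) (\<gamma> (real (Suc i) / real N))"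
proof (rule ccontr)
  let ?x = "\<lambda>i. \<gamma> (real i / real N)"
  assume "\<not> thesis"
  then have flat: "\<forall>i<N. f (?x i) - f (?x (Suc i)) \<le> \<beta> * dist (?x i) (?x (Suc i))"
    using that by (meson not_le)
  have "f (pathstart \<gamma>) - f (pathfinish \<gamma>) = (\<Sum>i<N. f (?x i) - f (?x (Suc i)))"
    using \<open>N > 0\<close> by (subst sum_lessThan_telescope') (simp add: pathstart_def pathfinish_def)
  also have "\<dots> \<le> \<beta> * (\<Sum>i<N. dist (?x i) (?x (Suc i)))"
    unfolding sum_distrib_left by (rule sum_mono) (use flat in auto)
  also have "\<dots> < \<beta> * B"
  proof -
    have "ereal (\<Sum>i<N. dist (?x i) (?x (Suc i))) < ereal B"
      using subdivision_le_path_length[OF \<open>N > 0\<close>] len by (rule le_less_trans)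
    then show ?thesis using \<open>\<beta> > 0\<close> by simp
  qed
  finally show False using B by simp
qed

lemma steep_near_exists:
  fixes f :: "'a::metric_space \<Rightarrow> real"
  assumes "length_space TYPE('a)" and "\<beta> > 0" and steep: "f p - f q > \<beta> * dist p q"
  obtains x where "x \<in> steep_near f \<beta>"
proof (rule ccontr)
  assume "\<not> thesis"
  then have "\<forall>x. x \<notin> steep_near f \<beta>" using that by blast
  then have "\<forall>x. \<exists>r>0. \<forall>p\<in>ball x r. \<forall>q\<in>ball x r. f p - f q \<le> \<beta> * dist p q"
    unfolding steep_near_def mem_Collect_eq by (meson not_less)
  then obtain r where r: "\<And>x. r x > 0"
      "\<And>x p q. p \<in> ball x (r x) \<Longrightarrow> q \<in> ball x (r x) \<Longrightarrow> f p - f q \<le> \<beta> * dist p q"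
    by metis
  define B where "B = (f p - f q) / \<beta>"
  have "dist p q < B" and B: "\<beta> * B = f p - f q"
    using steep \<open>\<beta> > 0\<close> by (auto simp: B_def field_simps)
  then have "(INF \<gamma> \<in> {\<gamma>. path \<gamma> \<and> pathstart \<gamma> = p \<and> pathfinish \<gamma> = q}. path_length \<gamma>) < ereal B"
    using assms(1) unfolding length_space_def by (metis ereal_less(2) less_ereal.simps(1))
  then obtain \<gamma> where \<gamma>: "path \<gamma>" "pathstart \<gamma> = p" "pathfinish \<gamma> = q" "path_length \<gamma> < ereal B"
    by (auto simp: INF_less_iff)
  \<comment> \<open>A Lebesgue number of the cover makes all short steps of the path non-steep.\<close>
  have "compact (path_image \<gamma>)" using \<gamma>(1) by (rule compact_path_image)
  moreover have "path_image \<gamma> \<subseteq> \<Union> (range (\<lambda>x. ball x (r x)))"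
  proof
    fix y
    have "y \<in> ball y (r y)" using r(1) by simp
    then show "y \<in> \<Union> (range (\<lambda>x. ball x (r x)))" by blast
  qed
  moreover have "open G" if "G \<in> range (\<lambda>x. ball x (r x))" for G
    using that by auto
  ultimately have "\<exists>e>0. \<forall>y\<in>path_image \<gamma>. \<exists>G\<in>range (\<lambda>x. ball x (r x)). ball y e \<subseteq> G"
    by (rule Heine_Borel_lemma) metis+
  then obtain e where e: "e > 0"
      "\<And>y. y \<in> path_image \<gamma> \<Longrightarrow> \<exists>G\<in>range (\<lambda>x. ball x (r x)). ball y e \<subseteq> G"
    by metis
  have "uniformly_continuous_on {0..1} \<gamma>"
    using \<gamma>(1) compact_uniformly_continuous path_def by blast
  then obtain d where d: "d > 0"
      "\<And>s t. s \<in> {0..1} \<Longrightarrow> t \<in> {0..1} \<Longrightarrow> dist t s < d \<Longrightarrow> dist (\<gamma> t) (\<gamma> s) < e"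
    using e(1) unfolding uniformly_continuous_on_def by metis
  obtain N where N: "N > 0" "inverse (real N) < d"
    using d(1) ex_inverse_of_nat_less by auto
  obtain i where i: "i < N" and steep_i:
    "f (\<gamma> (real i / real N)) - f (\<gamma> (real (Suc i) / real N))
       > \<beta> * dist (\<gamma> (real i / real N)) (\<gamma> (real (Suc i) / real N))"
    using steep_step_of_path[of \<gamma> B \<beta> f N] \<gamma> B \<open>\<beta> > 0\<close> N(1) by auto
  let ?s = "real i / real N" and ?t = "real (Suc i) / real N"
  have st: "?s \<in> {0..1}" "?t \<in> {0..1}" using i by auto
  have "dist ?t ?s = inverse (real N)"
    using N(1) by (simp add: dist_real_def field_simps flip: diff_divide_distrib)
  then have close: "dist (\<gamma> ?s) (\<gamma> ?t) < e"
    using d(2)[OF st] N(2) by (simp add: dist_commute)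
  have "\<gamma> ?s \<in> path_image \<gamma>" using st(1) unfolding path_image_def by blast
  then obtain x where "ball (\<gamma> ?s) e \<subseteq> ball x (r x)" using e(2) by blast
  moreover have "\<gamma> ?s \<in> ball (\<gamma> ?s) e" "\<gamma> ?t \<in> ball (\<gamma> ?s) e"
    using close e(1) by simp_all
  ultimately have "f (\<gamma> ?s) - f (\<gamma> ?t) \<le> \<beta> * dist (\<gamma> ?s) (\<gamma> ?t)"
    using r(2)[of "\<gamma> ?s" x "\<gamma> ?t"] by (simp only: subset_iff)
  then show False using steep_i by simp
qed

text \<open>Composition with the monotone \<open>1\<close>-Lipschitz map that collapses a band of values loses at most
  the width of the band from an increment, and never increases one. Away from the level of \<open>y\<close> this
  preserves steepness, so one excluded point after the other can be dealt with in this way.\<close>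

lemma steep_near_avoiding:
  fixes f :: "'a::metric_space \<Rightarrow> real"
  assumes "length_space TYPE('a)" and "\<beta> > 0" and "finite F"
    and "continuous_on UNIV f" and "f p - f q > \<beta> * dist p q"
  obtains x where "x \<in> steep_near f \<beta>" "x \<notin> F"
proof -
  have "\<exists>x. x \<in> steep_near f \<beta> \<and> x \<notin> F"
    using assms(3-5)
  proof (induction F arbitrary: f rule: finite_induct)
    case empty
    then show ?case using steep_near_exists[OF assms(1,2)] by blast
  next
    case (insert y F)
    \<comment> \<open>The band has width \<open>2h\<close>, half of the excess of the increment over \<open>\<beta> d(p, q)\<close>.\<close>
    define h where "h = (f p - f q - \<beta> * dist p q) / 4"
    define \<phi> where "\<phi> = (\<lambda>t. t - max (- h) (min h (t - f y)))"
    have "h > 0" using insert.prems(2) by (simp add: h_def)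
    have \<phi>_upper: "\<phi> s - \<phi> t \<le> s - t" if "t \<le> s" for s t
      using that by (auto simp: \<phi>_def)
    have \<phi>_mono: "\<phi> s \<le> \<phi> t" if "s \<le> t" for s t
      using that by (auto simp: \<phi>_def max_def min_def)
    have "f p - f q - 2 * h \<le> \<phi> (f p) - \<phi> (f q)"
      using \<open>h > 0\<close> by (auto simp: \<phi>_def max_def min_def)
    then have steep: "\<phi> (f p) - \<phi> (f q) > \<beta> * dist p q"
      using \<open>h > 0\<close> unfolding h_def by argo
    have "continuous_on UNIV (\<lambda>x. \<phi> (f x))"
      unfolding \<phi>_def by (intro continuous_intros insert.prems(1))
    from insert.IH[OF this steep] obtain x
      where x: "x \<in> steep_near (\<lambda>x. \<phi> (f x)) \<beta>" "x \<notin> F" by blast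
    have transfer_steep: "f u - f v > \<beta> * dist u v" if "\<phi> (f u) - \<phi> (f v) > \<beta> * dist u v" for u v
    proof -
      have "0 \<le> \<beta> * dist u v" using \<open>\<beta> > 0\<close> by simp
      then have "\<phi> (f v) < \<phi> (f u)" using that by linarith
      then have "f v \<le> f u" using \<phi>_mono[of "f u" "f v"] by linarith
      then show ?thesis using \<phi>_upper[of "f v" "f u"] that by linarith
    qed
    have "x \<in> steep_near f \<beta>"
      using x(1) transfer_steep unfolding steep_near_def by blast
    moreover have "x \<noteq> y"
    proof
      assume "x = y"
      have "isCont f y" using insert.prems(1) by (simp add: continuous_on_eq_continuous_at)
      then obtain r where r: "r > 0" "\<And>u. dist u y < r \<Longrightarrow> dist (f u) (f y) < h"
        using \<open>h > 0\<close> unfolding continuous_at_eps_delta by metis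
      have flat: "\<phi> (f u) = f y" if "u \<in> ball y r" for u
        using r(2)[of u] that by (auto simp: \<phi>_def dist_commute dist_real_def)
      obtain u v where "u \<in> ball y r" "v \<in> ball y r" "\<phi> (f u) - \<phi> (f v) > \<beta> * dist u v"
        using x(1) r(1) unfolding \<open>x = y\<close> steep_near_def by blast
      then have "\<beta> * dist u v < 0" using flat by simp
      then show False using \<open>\<beta> > 0\<close> by (simp add: mult_less_0_iff)
    qed
    ultimately show ?case using x(2) by blast
  qed
  then show ?thesis using that by blast
qed

lemma infinite_steep_near:
  fixes f :: "'a::metric_space \<Rightarrow> real"
  assumes "length_space TYPE('a)" and "\<beta> > 0"
    and "continuous_on UNIV f" and "f p - f q > \<beta> * dist p q"
  shows "infinite (steep_near f \<beta>)"
  using steep_near_avoiding[OF assms(1,2) _ assms(3,4)] by metis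

section \<open>Well separated steep pairs\<close>

lemma injective_choice_from_infinite_sets:
  assumes "finite J" and "\<And>j. j \<in> J \<Longrightarrow> infinite (A j)"
  obtains a where "inj_on a J" "\<And>j. j \<in> J \<Longrightarrow> a j \<in> A j"
proof -
  have "\<exists>a. inj_on a J \<and> (\<forall>j\<in>J. a j \<in> A j)"
    using assms
  proof (induction J rule: finite_induct)
    case (insert j J)
    then obtain a where a: "inj_on a J" "\<forall>i\<in>J. a i \<in> A i" by auto
    obtain x where x: "x \<in> A j" "x \<notin> a ` J"
      using insert.prems[of j] insert.hyps(1) by (meson finite_imageI finite_subset insertI1 subsetI)
    have "inj_on (a(j := x)) (insert j J) \<and> (\<forall>i\<in>insert j J. (a(j := x)) i \<in> A i)"
      using a x insert.hyps(2) by (auto simp: inj_on_def)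
    then show ?case by blast
  qed simp
  then show ?thesis using that by blast
qed

lemma separated_steep_pairs:
  fixes f :: "'j \<Rightarrow> 'a::metric_space \<Rightarrow> real"
  assumes "finite J" and inf: "\<And>j. j \<in> J \<Longrightarrow> infinite (steep_near (f j) (\<beta> j))"
  obtains p q where
    "\<And>j. j \<in> J \<Longrightarrow> f j (p j) - f j (q j) > \<beta> j * dist (p j) (q j)"
    "\<And>j k. j \<in> J \<Longrightarrow> k \<in> J \<Longrightarrow> j \<noteq> k \<Longrightarrow>
       dist (p j) (q j) + dist (p k) (q k) \<le> dist (p j) (p k)"
proof -
  obtain a where a: "inj_on a J" "\<And>j. j \<in> J \<Longrightarrow> a j \<in> steep_near (f j) (\<beta> j)"
    using injective_choice_from_infinite_sets[OF assms(1), of "\<lambda>j. steep_near (f j) (\<beta> j)"] inf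
    by blast
  obtain d where d: "d > 0" "\<And>x y. x \<in> a ` J \<Longrightarrow> y \<in> a ` J \<Longrightarrow> x \<noteq> y \<Longrightarrow> d \<le> dist x y"
  proof -
    define D where "D = insert 1 ((\<lambda>(x, y). dist x y) ` {(x, y) \<in> a ` J \<times> a ` J. x \<noteq> y})"
    have "finite {(x, y) \<in> a ` J \<times> a ` J. x \<noteq> y}"
      by (rule finite_subset[of _ "a ` J \<times> a ` J"]) (use \<open>finite J\<close> in auto)
    then have "finite D" by (simp add: D_def)
    show ?thesis
    proof (rule that[of "Min D"])
      have "\<And>z. z \<in> D \<Longrightarrow> z > 0" by (auto simp: D_def)
      then show "Min D > 0" using \<open>finite D\<close> by (simp add: D_def)
      show "Min D \<le> dist x y" if "x \<in> a ` J" "y \<in> a ` J" "x \<noteq> y" for x y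
        using that by (intro Min_le[OF \<open>finite D\<close>]) (force simp: D_def)
    qed
  qed
  \<comment> \<open>Balls of radius \<open>d / 6\<close> leave \<open>d - 2 d / 6 = 2 d / 3\<close> between the first points of two pairs,
    while each pair has length at most \<open>d / 3\<close>.\<close>
  have "\<exists>p q. p \<in> ball (a j) (d / 6) \<and> q \<in> ball (a j) (d / 6) \<and> f j p - f j q > \<beta> j * dist p q"
    if "j \<in> J" for j
  proof -
    have "0 < d / 6" using d(1) by simp
    then show ?thesis using a(2)[OF that] unfolding steep_near_def by blast
  qed
  then obtain p q where pq: "\<And>j. j \<in> J \<Longrightarrow> p j \<in> ball (a j) (d / 6)"
      "\<And>j. j \<in> J \<Longrightarrow> q j \<in> ball (a j) (d / 6)"
      "\<And>j. j \<in> J \<Longrightarrow> f j (p j) - f j (q j) > \<beta> j * dist (p j) (q j)"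
    by metis
  have short: "dist (p j) (q j) \<le> d / 3" if "j \<in> J" for j
    using pq(1,2)[OF that] dist_triangle3[of "p j" "q j" "a j"] by simp
  have "dist (p j) (q j) + dist (p k) (q k) \<le> dist (p j) (p k)"
    if "j \<in> J" "k \<in> J" "j \<noteq> k" for j k
  proof -
    have "a j \<noteq> a k" using a(1) that by (auto simp: inj_on_def)
    then have "d \<le> dist (a j) (a k)" using d(2) that by blast
    also have "\<dots> \<le> dist (a j) (p j) + dist (p j) (p k) + dist (a k) (p k)"
      using dist_triangle[of "a j" "a k" "p j"] dist_triangle2[of "p j" "a k" "p k"] by linarith
    finally have "d - d / 3 \<le> dist (p j) (p k)"
      using pq(1)[OF that(1)] pq(1)[OF that(2)] by simp
    then show ?thesis using short[OF that(1)] short[OF that(2)] by simp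
  qed
  with pq(3) show ?thesis by (rule that)
qed

section \<open>Signed sums of disjoint tents\<close>

definition tent :: "'a::metric_space \<Rightarrow> real \<Rightarrow> 'a \<Rightarrow> real" where
  "tent p r x = max 0 (r - dist x p)"

lemma tent_diff_le: "\<bar>tent p r x - tent p r y\<bar> \<le> dist x y"
  using dist_triangle[of x p y] dist_triangle3[of y p x] unfolding tent_def by linarith

lemma tent_disjoint:
  assumes "r + s \<le> dist p q" and "tent p r x > 0"
  shows "tent q s x = 0"
  using assms dist_triangle3[of p q x] unfolding tent_def by linarith

lemma tent_sum_le:
  assumes "r + s \<le> dist p q" and "tent p r x > 0" "tent q s y > 0"
  shows "tent p r x + tent q s y \<le> dist x y"
proof -
  have "dist p q \<le> dist x p + dist x y + dist y q"
    using dist_triangle3[of p q x] dist_triangle[of x q y] by linarith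
  then show ?thesis using assms unfolding tent_def by linarith
qed

text \<open>At each point at most one tent is nonzero. Two points in different tents are at least as far
  apart as the sum of the values of the two tents at them, so that even opposite signs do not raise
  the Lipschitz constant.\<close>

lemma lipschitz_signed_tents:
  fixes p :: "'j \<Rightarrow> 'a::metric_space" and \<sigma> :: "'j \<Rightarrow> real"
  assumes "finite J" and sep: "\<And>j k. j \<in> J \<Longrightarrow> k \<in> J \<Longrightarrow> j \<noteq> k \<Longrightarrow> r j + r k \<le> dist (p j) (p k)"
    and \<sigma>: "\<And>j. \<bar>\<sigma> j\<bar> = 1"
  shows "1-lipschitz_on UNIV (\<lambda>x. \<Sum>j\<in>J. \<sigma> j * tent (p j) (r j) x)"
proof (rule lipschitz_onI)
  let ?b = "\<lambda>j. tent (p j) (r j)" and ?g = "\<lambda>x. \<Sum>j\<in>J. \<sigma> j * tent (p j) (r j) x"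
  fix x y :: 'a
  show "dist (?g x) (?g y) \<le> 1 * dist x y"
  proof (cases "J = {}")
    case False
    have b_nonneg: "?b j z \<ge> 0" for j z by (simp add: tent_def)
    have single: "\<exists>j\<in>J. ?g z = \<sigma> j * ?b j z \<and> (\<forall>k\<in>J. k \<noteq> j \<longrightarrow> ?b k z = 0)" for z
    proof -
      obtain j where j: "j \<in> J" "\<forall>k\<in>J. k \<noteq> j \<longrightarrow> ?b k z = 0"
      proof (cases "\<exists>j\<in>J. ?b j z > 0")
        case True
        then obtain j where "j \<in> J" "?b j z > 0" by blast
        then show ?thesis using that tent_disjoint sep by metis
      next
        case False
        then show ?thesis using that \<open>J \<noteq> {}\<close> b_nonneg by (metis ex_in_conv less_eq_real_def)
      qed
      have "?g z = (\<Sum>k\<in>{j}. \<sigma> k * ?b k z)"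
        by (rule sum.mono_neutral_right) (use j \<open>finite J\<close> in auto)
      then show ?thesis using j by auto
    qed
    obtain j where j: "j \<in> J" "?g x = \<sigma> j * ?b j x" "\<And>k. k \<in> J \<Longrightarrow> k \<noteq> j \<Longrightarrow> ?b k x = 0"
      using single[of x] by metis
    obtain k where k: "k \<in> J" "?g y = \<sigma> k * ?b k y" "\<And>i. i \<in> J \<Longrightarrow> i \<noteq> k \<Longrightarrow> ?b i y = 0"
      using single[of y] by metis
    have "\<bar>\<sigma> j * ?b j x - \<sigma> k * ?b k y\<bar> \<le> dist x y"
    proof (cases "j = k")
      case True
      have "\<bar>\<sigma> j * ?b j x - \<sigma> j * ?b j y\<bar> = \<bar>\<sigma> j\<bar> * \<bar>?b j x - ?b j y\<bar>"
        by (simp flip: right_diff_distrib abs_mult)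
      then show ?thesis using tent_diff_le[of "p j" "r j" x y] \<sigma> True by simp
    next
      case False
      have "\<bar>\<sigma> j * ?b j x - \<sigma> k * ?b k y\<bar> \<le> \<bar>\<sigma> j * ?b j x\<bar> + \<bar>\<sigma> k * ?b k y\<bar>"
        by (rule abs_triangle_ineq4)
      also have "\<dots> = ?b j x + ?b k y" using \<sigma> b_nonneg by (simp add: abs_mult)
      also have "\<dots> \<le> dist x y"
      proof (cases "?b j x > 0 \<and> ?b k y > 0")
        case True
        then show ?thesis using tent_sum_le sep j(1) k(1) False by metis
      next
        case other: False
        have "?b j y = 0" "?b k x = 0" using j k False by auto
        then show ?thesis
          using other tent_diff_le[of "p j" "r j" x y] tent_diff_le[of "p k" "r k" x y]
            b_nonneg[of j x] b_nonneg[of k y] by linarith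
      qed
      finally show ?thesis .
    qed
    then show ?thesis using j(2) k(2) by (simp add: dist_real_def)
  qed simp
qed simp

section \<open>Molecules and functionals on the Lipschitz-free space\<close>

lift_definition point_mass :: "'a::{metric_space, zero} \<Rightarrow> 'a lipschitz_free" is delta
  by (rule subsetD[OF closure_subset]) (simp add: span_base)

lemma free_functional_simps [simp]:
  "free_functional (point_mass p) = delta p"
  "free_functional (\<mu> + \<nu>) = free_functional \<mu> + free_functional \<nu>"
  "free_functional (\<mu> - \<nu>) = free_functional \<mu> - free_functional \<nu>"
  "free_functional (c *\<^sub>R \<mu>) = c *\<^sub>R free_functional \<mu>"
  "free_functional 0 = 0"
  by (simp_all add: point_mass.rep_eq plus_lipschitz_free.rep_eq minus_lipschitz_free.rep_eq
      scaleR_lipschitz_free.rep_eq zero_lipschitz_free.rep_eq)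

lemma delta_apply [simp]: "blinfun_apply (delta p) f = lip0_apply f p"
  by (simp add: delta.rep_eq)

lemma norm_free_functional [simp]: "norm (free_functional \<mu>) = norm \<mu>"
  by (simp add: norm_lipschitz_free.rep_eq)

lemma norm_lip0_le:
  assumes "0 \<le> L" and "\<And>p q. lip0_apply f p - lip0_apply f q \<le> L * dist p q"
  shows "norm f \<le> L"
proof -
  have "\<bar>lip0_apply f p - lip0_apply f q\<bar> \<le> L * dist p q" for p q
    using assms(2)[of p q] assms(2)[of q p] by (simp add: dist_commute abs_le_iff)
  then show ?thesis
    unfolding norm_lip0_def
    by (intro cSup_least) (use assms(1) in \<open>auto simp: slopes_def divide_le_eq\<close>)
qed

lemma norm_point_mass_diff_le: "norm (point_mass p - point_mass q) \<le> dist p q"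
proof -
  have "norm (delta p - delta q) \<le> dist p q"
    by (rule norm_blinfun_bound)
      (use lip0_apply_diff_le[of _ p q] in \<open>auto simp: blinfun.diff_left mult.commute\<close>)
  then show ?thesis by (simp flip: norm_free_functional)
qed

definition molecule :: "'a::{metric_space, zero} \<Rightarrow> 'a \<Rightarrow> 'a lipschitz_free" where
  "molecule p q = (1 / dist p q) *\<^sub>R (point_mass p - point_mass q)"

lemma norm_molecule_le_1: "norm (molecule p q) \<le> 1"
  using norm_point_mass_diff_le[of p q] by (cases "p = q") (auto simp: molecule_def divide_le_eq)

lemma free_functional_molecule:
  "blinfun_apply (free_functional (molecule p q)) g = (lip0_apply g p - lip0_apply g q) / dist p q"
  by (simp add: molecule_def blinfun.scaleR_left blinfun.diff_left)

lemma lipschitz_on_functional_point_mass: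
  fixes \<Phi> :: "'a::{metric_space, zero} lipschitz_free \<Rightarrow>\<^sub>L real"
  shows "(norm \<Phi>)-lipschitz_on UNIV (\<lambda>p. blinfun_apply \<Phi> (point_mass p))"
proof (rule lipschitz_onI)
  fix p q :: 'a
  have "\<bar>blinfun_apply \<Phi> (point_mass p - point_mass q)\<bar> \<le> norm \<Phi> * norm (point_mass p - point_mass q)"
    using norm_blinfun[of \<Phi>] by simp
  also have "\<dots> \<le> norm \<Phi> * dist p q"
    by (intro mult_left_mono norm_point_mass_diff_le) simp
  finally show "dist (blinfun_apply \<Phi> (point_mass p)) (blinfun_apply \<Phi> (point_mass q)) \<le> norm \<Phi> * dist p q"
    by (simp add: dist_real_def blinfun.diff_right)
qed simp

lemma point_mass_zero [simp]: "point_mass 0 = 0"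
proof -
  have "delta (0::'a) = 0" by (rule blinfun_eqI) simp
  then show ?thesis by (simp flip: free_functional_inject)
qed

text \<open>This is the surjectivity of the canonical map from Lipschitz functions to the dual of the free
  space: both sides are continuous and linear in \<open>\<mu>\<close> and agree on the point masses, whose span is
  dense.\<close>

lemma functional_represented_by_lip0:
  fixes \<Phi> :: "'a::{metric_space, zero} lipschitz_free \<Rightarrow>\<^sub>L real"
  obtains f where "\<And>p. lip0_apply f p = blinfun_apply \<Phi> (point_mass p)"
    "\<And>\<mu>. blinfun_apply \<Phi> \<mu> = blinfun_apply (free_functional \<mu>) f"
proof -
  define f where "f = Abs_lip0 (\<lambda>p. blinfun_apply \<Phi> (point_mass p))"
  have f: "lip0_apply f p = blinfun_apply \<Phi> (point_mass p)" for p
    unfolding f_def using lipschitz_on_functional_point_mass[of \<Phi>]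
    by (subst Abs_lip0_inverse) auto
  have on_span: "\<exists>\<nu>. free_functional \<nu> = m \<and> blinfun_apply \<Phi> \<nu> = blinfun_apply m f"
    if "m \<in> span (range delta)" for m
    using that
  proof (induction rule: span_induct_alt)
    case base
    show ?case by (intro exI[of _ 0]) simp
  next
    case (step c d m)
    then obtain p \<nu> where "d = delta p" "free_functional \<nu> = m"
        "blinfun_apply \<Phi> \<nu> = blinfun_apply m f"
      by auto
    then show ?case
      by (intro exI[of _ "c *\<^sub>R point_mass p + \<nu>"])
        (simp add: blinfun.add_left blinfun.add_right blinfun.scaleR_left blinfun.scaleR_right f)
  qed
  have "blinfun_apply \<Phi> \<mu> = blinfun_apply (free_functional \<mu>) f" for \<mu>
  proof -
    obtain m where m: "\<And>n::nat. m n \<in> span (range delta)" "m \<longlonglongrightarrow> free_functional \<mu>"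
      using free_functional[of \<mu>] unfolding closure_sequential by blast
    obtain \<nu> where \<nu>: "\<And>n. free_functional (\<nu> n) = m n"
        "\<And>n. blinfun_apply \<Phi> (\<nu> n) = blinfun_apply (m n) f"
      using on_span[OF m(1)] by metis
    have "\<nu> \<longlonglongrightarrow> \<mu>"
      using m(2) by (simp add: tendsto_iff dist_free_functional flip: \<nu>(1))
    then have "(\<lambda>n. blinfun_apply \<Phi> (\<nu> n)) \<longlonglongrightarrow> blinfun_apply \<Phi> \<mu>"
      by (intro tendsto_intros)
    moreover have "(\<lambda>n. blinfun_apply (m n) f) \<longlonglongrightarrow> blinfun_apply (free_functional \<mu>) f"
      by (intro tendsto_intros m(2))
    ultimately show ?thesis unfolding \<nu>(2) by (rule LIMSEQ_unique)
  qed
  with f show ?thesis using that by blast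
qed

text \<open>Otherwise the Lipschitz function representing \<open>\<Phi>\<close> would have norm at most \<open>\<beta>\<close>, hence so would
  \<open>\<Phi>\<close>.\<close>

lemma steep_pair_of_functional:
  fixes \<Phi> :: "'a::{metric_space, zero} lipschitz_free \<Rightarrow>\<^sub>L real"
  assumes "0 \<le> \<beta>" and "\<beta> < norm \<Phi>"
  obtains p q where
    "blinfun_apply \<Phi> (point_mass p) - blinfun_apply \<Phi> (point_mass q) > \<beta> * dist p q"
proof (rule ccontr)
  assume neg: "\<not> thesis"
  obtain f where f: "\<And>p. lip0_apply f p = blinfun_apply \<Phi> (point_mass p)"
    "\<And>\<mu>. blinfun_apply \<Phi> \<mu> = blinfun_apply (free_functional \<mu>) f"
    by (rule functional_represented_by_lip0[of \<Phi>]) blast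
  have "norm f \<le> \<beta>"
    by (rule norm_lip0_le) (use assms(1) neg that in \<open>auto simp: f(1) not_less[symmetric]\<close>)
  have "norm \<Phi> \<le> \<beta>"
  proof (rule norm_blinfun_bound)
    fix \<mu>
    have "norm (blinfun_apply \<Phi> \<mu>) \<le> norm \<mu> * norm f"
      using norm_blinfun[of "free_functional \<mu>" f] by (simp add: f(2))
    also have "\<dots> \<le> norm \<mu> * \<beta>" by (intro mult_left_mono \<open>norm f \<le> \<beta>\<close>) simp
    finally show "norm (blinfun_apply \<Phi> \<mu>) \<le> \<beta> * norm \<mu>" by (simp add: mult.commute)
  qed (rule assms(1))
  then show False using assms(2) by simp
qed

lemma infinite_steep_near_functional:
  fixes \<Phi> :: "'a::{metric_space, zero} lipschitz_free \<Rightarrow>\<^sub>L real"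
  assumes "length_space TYPE('a)" and "0 < \<beta>" and "\<beta> < norm \<Phi>"
  shows "infinite (steep_near (\<lambda>p. blinfun_apply \<Phi> (point_mass p)) \<beta>)"
proof -
  obtain p q where
    "blinfun_apply \<Phi> (point_mass p) - blinfun_apply \<Phi> (point_mass q) > \<beta> * dist p q"
    using steep_pair_of_functional[of \<beta> \<Phi>] assms by auto
  then show ?thesis
    using lipschitz_on_continuous_on[OF lipschitz_on_functional_point_mass[of \<Phi>]]
    by (intro infinite_steep_near[OF assms(1,2)])
qed

lemma molecule_in_slice:
  fixes \<Phi> :: "'a::{metric_space, zero} lipschitz_free \<Rightarrow>\<^sub>L real"
  assumes "0 \<le> \<beta>" "1 - \<alpha> \<le> \<beta>"
    and steep: "blinfun_apply \<Phi> (point_mass p) - blinfun_apply \<Phi> (point_mass q) > \<beta> * dist p q"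
  shows "molecule p q \<in> slice \<Phi> \<alpha>"
proof -
  have "p \<noteq> q" using steep by auto
  then have "\<beta> < blinfun_apply \<Phi> (molecule p q)"
    using steep by (simp add: molecule_def blinfun.scaleR_right blinfun.diff_right less_divide_eq)
  then show ?thesis using norm_molecule_le_1 assms(2) by (auto simp: slice_def)
qed

lemma lip0_of_lipschitz:
  fixes g :: "'a::{metric_space, zero} \<Rightarrow> real"
  assumes "1-lipschitz_on UNIV g"
  obtains G where "norm G \<le> 1" "\<And>p q. lip0_apply G p - lip0_apply G q = g p - g q"
proof -
  have "1-lipschitz_on UNIV (\<lambda>x. g x - g 0)"
    using assms unfolding lipschitz_on_def by (simp add: dist_real_def)
  then have G: "lip0_apply (Abs_lip0 (\<lambda>x. g x - g 0)) = (\<lambda>x. g x - g 0)"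
    by (subst Abs_lip0_inverse) auto
  have "norm (Abs_lip0 (\<lambda>x. g x - g 0)) \<le> 1"
  proof (rule norm_lip0_le)
    fix p q
    show "lip0_apply (Abs_lip0 (\<lambda>x. g x - g 0)) p - lip0_apply (Abs_lip0 (\<lambda>x. g x - g 0)) q
        \<le> 1 * dist p q"
      unfolding G using lipschitz_onD[OF assms, of p q] by (simp add: dist_real_def)
  qed simp
  then show ?thesis using that G by simp
qed

lemma norm_convex_combination_le_1:
  assumes "\<And>i. i \<in> I \<Longrightarrow> 0 \<le> c i" and "(\<Sum>i\<in>I. c i) = 1" and "\<And>i. i \<in> I \<Longrightarrow> norm (x i) \<le> 1"
  shows "norm (\<Sum>i\<in>I. c i *\<^sub>R x i) \<le> (1::real)"
proof -
  have "norm (\<Sum>i\<in>I. c i *\<^sub>R x i) \<le> (\<Sum>i\<in>I. c i)"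
    by (rule sum_norm_le) (use assms in \<open>simp add: mult_left_le\<close>)
  then show ?thesis using assms(2) by simp
qed

lemma free_functional_sum: "free_functional (\<Sum>i\<in>I. x i) = (\<Sum>i\<in>I. free_functional (x i))"
  by (induction I rule: infinite_finite_induct) auto

section \<open>The attaining strong diameter two property\<close>

theorem theorem2p2:
  assumes "length_space TYPE('a::{metric_space, zero})"
  shows "ASD2P TYPE('a lipschitz_free)"
  unfolding ASD2P_def
proof (intro allI impI)
  fix C :: "'a lipschitz_free set"
  assume "convex_combination_of_slices C"
  then obtain n :: nat and c S where
      slices: "\<forall>i\<in>{1..n}. c i > 0 \<and> is_slice (S i)" and c_sum: "(\<Sum>i=1..n. c i) = 1"
    and C: "C = {(\<Sum>i=1..n. c i *\<^sub>R x i) | x. \<forall>i\<in>{1..n}. x i \<in> S i}"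
    unfolding convex_combination_of_slices_def by (elim exE conjE)
  have "\<exists>\<Phi> \<alpha>. norm \<Phi> = 1 \<and> \<alpha> > 0 \<and> S i = slice \<Phi> \<alpha>" if "i \<in> {1..n}" for i
    using bspec[OF slices that] unfolding is_slice_def by blast
  then obtain \<Phi> \<alpha> where S: "\<And>i. i \<in> {1..n} \<Longrightarrow> norm (\<Phi> i) = 1"
      "\<And>i. i \<in> {1..n} \<Longrightarrow> \<alpha> i > 0" "\<And>i. i \<in> {1..n} \<Longrightarrow> S i = slice (\<Phi> i) (\<alpha> i)"
    by metis
  \<comment> \<open>A slice may have \<open>\<alpha> \<ge> 1\<close>, while steep pairs can be localised along a path only for a
    positive slope.\<close>
  define \<beta> where "\<beta> i = max (1 / 2) (1 - \<alpha> i)" for i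
  \<comment> \<open>Two pairs for each slice, distinguished by a Boolean that decides the sign of the tent.\<close>
  define J where "J = {1..n} \<times> (UNIV :: bool set)"
  define \<sigma> where "\<sigma> j = (if snd j then 1 else - 1 :: real)" for j :: "nat \<times> bool"
  have inf: "infinite (steep_near (\<lambda>p. blinfun_apply (\<Phi> (fst j)) (point_mass p)) (\<beta> (fst j)))"
    if "j \<in> J" for j
  proof (rule infinite_steep_near_functional[OF assms])
    have "fst j \<in> {1..n}" using that by (auto simp: J_def)
    then show "\<beta> (fst j) < norm (\<Phi> (fst j))" using S(1,2) by (simp add: \<beta>_def)
  qed (simp add: \<beta>_def)
  have "finite J" by (simp add: J_def)
  then obtain p q where
    steep: "\<And>j. j \<in> J \<Longrightarrow> blinfun_apply (\<Phi> (fst j)) (point_mass (p j))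
        - blinfun_apply (\<Phi> (fst j)) (point_mass (q j)) > \<beta> (fst j) * dist (p j) (q j)"
    and sep: "\<And>j k. j \<in> J \<Longrightarrow> k \<in> J \<Longrightarrow> j \<noteq> k \<Longrightarrow>
        dist (p j) (q j) + dist (p k) (q k) \<le> dist (p j) (p k)"
    using separated_steep_pairs[where J = J and \<beta> = "\<lambda>j. \<beta> (fst j)"
        and f = "\<lambda>j p. blinfun_apply (\<Phi> (fst j)) (point_mass p)"] inf by blast
  define g where "g x = (\<Sum>j\<in>J. \<sigma> j * tent (p j) (dist (p j) (q j)) x)" for x
  have "1-lipschitz_on UNIV g"
    unfolding g_def by (rule lipschitz_signed_tents) (use \<open>finite J\<close> sep in \<open>auto simp: \<sigma>_def\<close>)
  then obtain G where G: "norm G \<le> 1" "\<And>x y. lip0_apply G x - lip0_apply G y = g x - g y"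
    by (rule lip0_of_lipschitz) blast
  have dist_pos: "dist (p j) (q j) > 0" if "j \<in> J" for j
    using steep[OF that] by auto
  have g_pq: "g (p j) - g (q j) = \<sigma> j * dist (p j) (q j)" if "j \<in> J" for j
  proof -
    have "tent (p k) (dist (p k) (q k)) (p j) = 0" "tent (p k) (dist (p k) (q k)) (q j) = 0"
      if "k \<in> J" "k \<noteq> j" for k
      using sep[OF that(1) \<open>j \<in> J\<close> that(2)] dist_triangle2[of "p k" "p j" "q j"]
        zero_le_dist[of "p j" "q j"] dist_commute[of "p j" "p k"] dist_commute[of "q j" "p k"]
      unfolding tent_def by linarith+
    then have "g (p j) = (\<Sum>k\<in>{j}. \<sigma> k * tent (p k) (dist (p k) (q k)) (p j))"
      "g (q j) = (\<Sum>k\<in>{j}. \<sigma> k * tent (p k) (dist (p k) (q k)) (q j))"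
      unfolding g_def
      by (intro sum.mono_neutral_right; use that \<open>finite J\<close> in auto)+
    then show ?thesis by (simp add: tent_def dist_commute)
  qed
  define x where "x b = (\<Sum>i=1..n. c i *\<^sub>R molecule (p (i, b)) (q (i, b)))" for b
  have in_C: "x b \<in> C" for b
  proof -
    have "molecule (p (i, b)) (q (i, b)) \<in> S i" if "i \<in> {1..n}" for i
      unfolding S(3)[OF that] using steep[of "(i, b)"] that
      by (intro molecule_in_slice[of "\<beta> i"]) (auto simp: J_def \<beta>_def)
    then show ?thesis
      unfolding C x_def mem_Collect_eq
      by (intro exI[of _ "\<lambda>i. molecule (p (i, b)) (q (i, b))"] conjI refl ballI)
  qed
  have G_x: "blinfun_apply (free_functional (x b)) G = (if b then 1 else - 1)" for b
  proof -
    have "blinfun_apply (free_functional (x b)) G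
        = (\<Sum>i=1..n. c i * ((g (p (i, b)) - g (q (i, b))) / dist (p (i, b)) (q (i, b))))"
      by (simp add: x_def free_functional_sum blinfun.sum_left blinfun.scaleR_left
          free_functional_molecule G(2))
    also have "\<dots> = (\<Sum>i=1..n. c i * (if b then 1 else - 1))"
    proof (rule sum.cong)
      fix i assume "i \<in> {1..n}"
      then have "(i, b) \<in> J" by (simp add: J_def)
      then show "c i * ((g (p (i, b)) - g (q (i, b))) / dist (p (i, b)) (q (i, b)))
          = c i * (if b then 1 else - 1)"
        using g_pq dist_pos by (simp add: \<sigma>_def)
    qed simp
    also have "\<dots> = (if b then 1 else - 1)"
      using c_sum by (simp flip: sum_distrib_right)
    finally show ?thesis .
  qed
  have norm_x: "norm (x b) \<le> 1" for b
    unfolding x_def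
    by (rule norm_convex_combination_le_1)
      (use slices c_sum norm_molecule_le_1 in \<open>auto intro: less_imp_le\<close>)
  have "2 = blinfun_apply (free_functional (x True - x False)) G"
    by (simp add: blinfun.diff_left G_x)
  also have "\<dots> \<le> norm (x True - x False) * norm G"
    using norm_blinfun[of "free_functional (x True - x False)" G]
    unfolding norm_free_functional by simp
  also have "\<dots> \<le> norm (x True - x False)"
    using G(1) by (simp add: mult_left_le)
  finally have "2 \<le> norm (x True - x False)" .
  moreover have "norm (x True - x False) \<le> 2"
    using norm_triangle_ineq4[of "x True" "x False"] norm_x[of True] norm_x[of False] by linarith
  ultimately show "\<exists>x\<in>C. \<exists>y\<in>C. norm (x - y) = 2"
    using in_C by (intro bexI[of _ "x True"] bexI[of _ "x False"]) auto
qed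

end
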